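(* Let $x: M^n \to E^{n+1}$ be an isometric immersion of an $n$-dimensional Riemannian manifold $(M^n,g)$ as a hypersurface of the Euclidean space $E^{n+1}$. Suppose that $M^n$ is a biharmonic hypersurface and that its shape operator $A$ is recurrent, i.e. there exists a $1$-form $\eta$ on $M^n$ such that $(\nabla_X A)Y=\eta(X)\,A(Y)$ for all $X,Y$ tangent to $M^n$. Then $M^n$ is minimal.
   Context: $\nabla$ is the Levi-Civita connection of $(M^n,g)$. Let $N$ be a local unit normal field, $A$ the shape (Weingarten) operator, and $\overrightarrow{H}=HN$ the mean curvature vector field, where $nH=\mathrm{trace}\,A$. The Laplacian is $\Delta=-\mathrm{trace}\,\nabla^2$, so that $\Delta x=-n\overrightarrow{H}$ (applied componentwise to $E^{n+1}$-valued functions). The hypersurface is biharmonic if $\Delta \overrightarrow{H}=0$; equivalently, $\Delta^{\perp}H+H\,\mathrm{trace}A^2=0$ and $2A(\mathrm{grad}\,H)+nH\,\mathrm{grad}\,H=0$, where $\Delta^{\perp}$ is the Laplacian in the normal bundle. Minimal means $H\equiv 0$. *)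

theory Defs
  imports "HOL-Analysis.Analysis"
begin

section \<open>Smooth manifolds\<close>

primrec Ck_on :: "nat \<Rightarrow> 'v::real_normed_vector set \<Rightarrow> ('v \<Rightarrow> 'w::real_normed_vector) \<Rightarrow> bool" where
  "Ck_on 0 S f \<longleftrightarrow> continuous_on S f"
| "Ck_on (Suc k) S f \<longleftrightarrow>
     (\<forall>u\<in>S. f differentiable (at u)) \<and> (\<forall>v. Ck_on k S (\<lambda>u. frechet_derivative f (at u) v))"

text \<open>Intended for open \<open>S\<close> only, since derivatives are taken in the whole space.\<close>

definition smooth_on :: "'v::real_normed_vector set \<Rightarrow> ('v \<Rightarrow> 'w::real_normed_vector) \<Rightarrow> bool" where
  "smooth_on S f \<longleftrightarrow> (\<forall>k. Ck_on k S f)"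

text \<open>A chart is a pair of its domain and its coordinate map; only the values of the coordinate
  map on the domain matter.\<close>

type_synonym ('a, 'n) chart = "'a set \<times> ('a \<Rightarrow> real ^ 'n)"

abbreviation chart_dom :: "('a, 'n) chart \<Rightarrow> 'a set" where
  "chart_dom c \<equiv> fst c"

abbreviation coord :: "('a, 'n) chart \<Rightarrow> 'a \<Rightarrow> real ^ 'n" where
  "coord c \<equiv> snd c"

definition chart_inv :: "('a, 'n) chart \<Rightarrow> real ^ 'n \<Rightarrow> 'a" where
  "chart_inv c = inv_into (chart_dom c) (coord c)"

definition is_chart :: "('a::topological_space, 'n::finite) chart \<Rightarrow> bool" where
  "is_chart c \<longleftrightarrow> open (chart_dom c) \<and> open (coord c ` chart_dom c) \<and>
     homeomorphism (chart_dom c) (coord c ` chart_dom c) (coord c) (chart_inv c)"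

text \<open>The manifold described by an atlas is the union of the chart domains, an open subset of the
  underlying Hausdorff and second countable space. Its dimension is \<open>CARD('n)\<close>.\<close>

definition smooth_atlas ::
  "('a::{t2_space, second_countable_topology}, 'n::finite) chart set \<Rightarrow> bool" where
  "smooth_atlas \<A> \<longleftrightarrow> (\<forall>c\<in>\<A>. is_chart c) \<and>
     (\<forall>c\<in>\<A>. \<forall>d\<in>\<A>. smooth_on (coord c ` (chart_dom c \<inter> chart_dom d)) (coord d \<circ> chart_inv c))"

definition manifold :: "('a, 'n) chart set \<Rightarrow> 'a set" where
  "manifold \<A> = (\<Union>c\<in>\<A>. chart_dom c)"

definition smooth_map_on ::
  "('a, 'n::finite) chart set \<Rightarrow> 'a set \<Rightarrow> ('a \<Rightarrow> 'w::real_normed_vector) \<Rightarrow> bool" where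
  "smooth_map_on \<A> W F \<longleftrightarrow>
     (\<forall>c\<in>\<A>. smooth_on (coord c ` (W \<inter> chart_dom c)) (F \<circ> chart_inv c))"

text \<open>A tangent vector at \<open>p\<close> is represented, in each chart \<open>c\<close> around \<open>p\<close>, by its components
  \<open>X :: real ^ 'n\<close> with respect to the coordinate basis. \<open>dmap c F p X\<close> is the derivative of \<open>F\<close>
  at \<open>p\<close> in the direction of this vector. In particular \<open>dmap c (coord d) p X\<close> gives the
  components in the chart \<open>d\<close> of the tangent vector with components \<open>X\<close> in the chart \<open>c\<close>.\<close>

definition dmap ::
  "('a, 'n::finite) chart \<Rightarrow> ('a \<Rightarrow> 'w::real_normed_vector) \<Rightarrow> 'a \<Rightarrow> real ^ 'n \<Rightarrow> 'w" where
  "dmap c F p X = frechet_derivative (F \<circ> chart_inv c) (at (coord c p)) X"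

text \<open>Tensor fields are given by their components in every chart of the atlas, subject to the
  transformation law under change of charts.\<close>

definition one_form ::
  "('a, 'n::finite) chart set \<Rightarrow> (('a, 'n) chart \<Rightarrow> 'a \<Rightarrow> real ^ 'n \<Rightarrow> real) \<Rightarrow> bool" where
  "one_form \<A> \<eta> \<longleftrightarrow>
     (\<forall>c\<in>\<A>. \<forall>p\<in>chart_dom c. linear (\<eta> c p)) \<and>
     (\<forall>c\<in>\<A>. \<forall>X. smooth_on (coord c ` chart_dom c) ((\<lambda>p. \<eta> c p X) \<circ> chart_inv c)) \<and>
     (\<forall>c\<in>\<A>. \<forall>d\<in>\<A>. \<forall>p\<in>chart_dom c \<inter> chart_dom d. \<forall>X.
        \<eta> c p X = \<eta> d p (dmap c (coord d) p X))"


section \<open>Riemannian metrics\<close>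

type_synonym ('a, 'n) metric = "('a, 'n) chart \<Rightarrow> 'a \<Rightarrow> real ^ 'n \<Rightarrow> real ^ 'n \<Rightarrow> real"

definition riemannian_metric :: "('a, 'n::finite) chart set \<Rightarrow> ('a, 'n) metric \<Rightarrow> bool" where
  "riemannian_metric \<A> g \<longleftrightarrow>
     (\<forall>c\<in>\<A>. \<forall>p\<in>chart_dom c. bilinear (g c p) \<and> (\<forall>X Y. g c p X Y = g c p Y X) \<and>
        (\<forall>X. X \<noteq> 0 \<longrightarrow> g c p X X > 0)) \<and>
     (\<forall>c\<in>\<A>. \<forall>X Y. smooth_on (coord c ` chart_dom c) ((\<lambda>p. g c p X Y) \<circ> chart_inv c)) \<and>
     (\<forall>c\<in>\<A>. \<forall>d\<in>\<A>. \<forall>p\<in>chart_dom c \<inter> chart_dom d. \<forall>X Y.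
        g c p X Y = g d p (dmap c (coord d) p X) (dmap c (coord d) p Y))"

text \<open>The Levi-Civita connection in a chart: \<open>levi_civita g c p X Y\<close> is \<open>\<nabla>\<^sub>X Y\<close> at \<open>p\<close> for vector
  fields \<open>X\<close>, \<open>Y\<close> with constant components. Such fields commute, so the three conditions say that
  the connection is tensorial up to the derivative of \<open>Y\<close>, torsion-free, and metric.\<close>

definition levi_civita ::
  "('a, 'n::finite) metric \<Rightarrow> ('a, 'n) chart \<Rightarrow> 'a \<Rightarrow> real ^ 'n \<Rightarrow> real ^ 'n \<Rightarrow> real ^ 'n" where
  "levi_civita g c p = (THE \<Gamma>. bilinear \<Gamma> \<and> (\<forall>X Y. \<Gamma> X Y = \<Gamma> Y X) \<and>
     (\<forall>X Y Z. dmap c (\<lambda>q. g c q Y Z) p X = g c p (\<Gamma> X Y) Z + g c p Y (\<Gamma> X Z)))"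

text \<open>\<open>\<nabla>\<^sub>X Y\<close> at \<open>p\<close>, for a vector field \<open>Y\<close> and a tangent vector \<open>X\<close> at \<open>p\<close>.\<close>

definition cov_deriv ::
  "('a, 'n::finite) metric \<Rightarrow> ('a, 'n) chart \<Rightarrow> real ^ 'n \<Rightarrow> ('a \<Rightarrow> real ^ 'n) \<Rightarrow> 'a \<Rightarrow> real ^ 'n"
  where "cov_deriv g c X Y p = dmap c Y p X + levi_civita g c p X (Y p)"

text \<open>\<open>(\<nabla>\<^sub>X A) Y = \<nabla>\<^sub>X (A Y) - A (\<nabla>\<^sub>X Y)\<close> for a field \<open>A\<close> of endomorphisms.\<close>

definition cov_deriv_endo ::
  "('a, 'n::finite) metric \<Rightarrow> ('a, 'n) chart \<Rightarrow> real ^ 'n \<Rightarrow> ('a \<Rightarrow> real ^ 'n \<Rightarrow> real ^ 'n)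
     \<Rightarrow> ('a \<Rightarrow> real ^ 'n) \<Rightarrow> 'a \<Rightarrow> real ^ 'n" where
  "cov_deriv_endo g c X A Y p =
     cov_deriv g c X (\<lambda>q. A q (Y q)) p - A p (cov_deriv g c X Y p)"

text \<open>\<open>(\<nabla>\<^sup>2 F)(X, Y) = X (Y F) - (\<nabla>\<^sub>X Y) F\<close>, evaluated with constant components \<open>X\<close>, \<open>Y\<close>.\<close>

definition hessian ::
  "('a, 'n::finite) metric \<Rightarrow> ('a, 'n) chart \<Rightarrow> ('a \<Rightarrow> 'w::real_normed_vector) \<Rightarrow> 'a
     \<Rightarrow> real ^ 'n \<Rightarrow> real ^ 'n \<Rightarrow> 'w" where
  "hessian g c F p X Y =
     dmap c (\<lambda>q. dmap c F q Y) p X - dmap c F p (levi_civita g c p X Y)"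

definition metric_matrix ::
  "('a, 'n::finite) metric \<Rightarrow> ('a, 'n) chart \<Rightarrow> 'a \<Rightarrow> real ^ 'n ^ 'n" where
  "metric_matrix g c p = (\<chi> i j. g c p (axis i 1) (axis j 1))"

text \<open>Sign convention: \<open>\<Delta> = - trace \<nabla>\<^sup>2\<close>, the trace being taken with respect to the metric.\<close>

definition laplacian ::
  "('a, 'n::finite) metric \<Rightarrow> ('a, 'n) chart \<Rightarrow> ('a \<Rightarrow> 'w::real_normed_vector) \<Rightarrow> 'a \<Rightarrow> 'w" where
  "laplacian g c F p =
     - (\<Sum>i\<in>UNIV. \<Sum>j\<in>UNIV.
          matrix_inv (metric_matrix g c p) $ i $ j *\<^sub>R hessian g c F p (axis i 1) (axis j 1))"


section \<open>Hypersurfaces\<close>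

definition isometric_immersion ::
  "('a, 'n::finite) chart set \<Rightarrow> ('a, 'n) metric \<Rightarrow> ('a \<Rightarrow> 'e::euclidean_space) \<Rightarrow> bool" where
  "isometric_immersion \<A> g x \<longleftrightarrow>
     smooth_map_on \<A> (manifold \<A>) x \<and>
     (\<forall>c\<in>\<A>. \<forall>p\<in>chart_dom c. inj (dmap c x p)) \<and>
     (\<forall>c\<in>\<A>. \<forall>p\<in>chart_dom c. \<forall>X Y. g c p X Y = dmap c x p X \<bullet> dmap c x p Y)"

definition local_unit_normal ::
  "('a::topological_space, 'n::finite) chart set \<Rightarrow> ('a \<Rightarrow> 'e::euclidean_space)
     \<Rightarrow> 'a set \<Rightarrow> ('a \<Rightarrow> 'e) \<Rightarrow> bool" where
  "local_unit_normal \<A> x W N \<longleftrightarrow>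
     open W \<and> W \<subseteq> manifold \<A> \<and> smooth_map_on \<A> W N \<and>
     (\<forall>p\<in>W. norm (N p) = 1) \<and>
     (\<forall>c\<in>\<A>. \<forall>p\<in>W \<inter> chart_dom c. \<forall>X. N p \<bullet> dmap c x p X = 0)"

text \<open>Weingarten's formula \<open>dx (A X) = - dN (X)\<close>; \<open>dN (X)\<close> is tangent to the hypersurface because
  \<open>N\<close> has unit length and the codimension is one.\<close>

definition shape_operator ::
  "('a \<Rightarrow> 'e::euclidean_space) \<Rightarrow> ('a, 'n::finite) chart \<Rightarrow> ('a \<Rightarrow> 'e) \<Rightarrow> 'a
     \<Rightarrow> real ^ 'n \<Rightarrow> real ^ 'n" where
  "shape_operator x c N p X = (THE V. dmap c x p V = - dmap c N p X)"

definition mean_curvature ::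
  "('a \<Rightarrow> 'e::euclidean_space) \<Rightarrow> ('a, 'n::finite) chart \<Rightarrow> ('a \<Rightarrow> 'e) \<Rightarrow> 'a \<Rightarrow> real" where
  "mean_curvature x c N p = trace (matrix (shape_operator x c N p)) / real CARD('n)"

definition mean_curvature_vector ::
  "('a \<Rightarrow> 'e::euclidean_space) \<Rightarrow> ('a, 'n::finite) chart \<Rightarrow> ('a \<Rightarrow> 'e) \<Rightarrow> 'a \<Rightarrow> 'e" where
  "mean_curvature_vector x c N p = mean_curvature x c N p *\<^sub>R N p"

text \<open>The shape operator and the mean curvature depend on the local unit normal field only through
  its sign, so the following conditions are imposed for all such fields.\<close>

definition biharmonic ::
  "('a::topological_space, 'n::finite) chart set \<Rightarrow> ('a, 'n) metric
     \<Rightarrow> ('a \<Rightarrow> 'e::euclidean_space) \<Rightarrow> bool" where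
  "biharmonic \<A> g x \<longleftrightarrow>
     (\<forall>W N. local_unit_normal \<A> x W N \<longrightarrow>
        (\<forall>c\<in>\<A>. \<forall>p\<in>W \<inter> chart_dom c. laplacian g c (mean_curvature_vector x c N) p = 0))"

definition recurrent_shape_operator ::
  "('a::topological_space, 'n::finite) chart set \<Rightarrow> ('a, 'n) metric
     \<Rightarrow> ('a \<Rightarrow> 'e::euclidean_space) \<Rightarrow> bool" where
  "recurrent_shape_operator \<A> g x \<longleftrightarrow>
     (\<exists>\<eta>. one_form \<A> \<eta> \<and>
        (\<forall>W N. local_unit_normal \<A> x W N \<longrightarrow>
           (\<forall>c\<in>\<A>. \<forall>p\<in>W \<inter> chart_dom c. \<forall>X Y.
              smooth_on (coord c ` (W \<inter> chart_dom c)) (Y \<circ> chart_inv c) \<longrightarrow>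
              cov_deriv_endo g c X (shape_operator x c N) Y p
                = \<eta> c p X *\<^sub>R shape_operator x c N p (Y p))))"

definition minimal ::
  "('a::topological_space, 'n::finite) chart set \<Rightarrow> ('a \<Rightarrow> 'e::euclidean_space) \<Rightarrow> bool" where
  "minimal \<A> x \<longleftrightarrow>
     (\<forall>W N. local_unit_normal \<A> x W N \<longrightarrow>
        (\<forall>c\<in>\<A>. \<forall>p\<in>W \<inter> chart_dom c. mean_curvature x c N p = 0))"

end

theory Submission
  imports Defs
begin

text \<open>Everything is local, so let \<open>f\<close> be the immersion in a chart, \<open>\<nu>\<close> the unit normal, \<open>A\<close> the
  shape operator and \<open>H\<close> the mean curvature. Three consequences of recurrence are combined.

  Taking the trace of \<open>(\<nabla>\<^sub>X A) Y = \<eta>(X) A Y\<close> gives \<open>dH = H \<eta>\<close> (\<open>mean_curv_has_derivative\<close>). The second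
  derivative of \<open>\<nu>\<close> is computed from Weingarten's formula (\<open>d2\<nu>_recurrent\<close>), and its symmetry is the
  Codazzi equation \<open>\<eta>(X) d\<nu>(Y) = \<eta>(Y) d\<nu>(X)\<close> (\<open>codazzi_recurrent\<close>). With both, the Hessian of the
  mean curvature vector \<open>H \<nu>\<close> becomes
  \<open>H (... \<nu> + 3 \<eta>(X) d\<nu>(Y))\<close> (\<open>hessian_mean_curv_vector\<close>), where the coefficient of \<open>\<nu>\<close> is
  \<open>\<eta>(X) \<eta>(Y) + (\<nabla>\<^sub>X \<eta>)(Y) - d\<nu>(X) \<bullet> d\<nu>(Y)\<close>.

  Suppose \<open>H\<close> does not vanish at some point. The tangential part of the biharmonic equation says that
  the trace of \<open>\<eta>(X) d\<nu>(Y)\<close> is zero. Multiplied by \<open>\<eta>(Z)\<close> it turns, by Codazzi, into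
  \<open>|\<eta>|\<^sup>2 d\<nu>(Z) = 0\<close>; since \<open>H\<close> is nonzero, so is \<open>d\<nu>\<close>, and therefore \<open>\<eta> = 0\<close>. This holds on the whole
  open set where \<open>H\<close> is nonzero, so the normal part there is \<open>|d\<nu>|\<^sup>2 = 0\<close>, which contradicts
  \<open>H \<noteq> 0\<close> (\<open>biharmonic_imp_mean_curv_eq_0\<close>).

  The Levi-Civita connection is the tangential part of the second derivative of \<open>f\<close>
  (\<open>levi_civita_unique\<close>), and mixed partial derivatives agree (\<open>symmetric_second_derivative\<close>).\<close>


section \<open>Smooth functions and the symmetry of second derivatives\<close>

lemma smooth_on_differentiable:
  assumes "smooth_on S f" "u \<in> S"
  shows "f differentiable (at u)"
  using assms Ck_on.simps(2)[of 0 S f] unfolding smooth_on_def by blast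

lemma smooth_on_has_derivative:
  assumes "smooth_on S f" "u \<in> S"
  shows "(f has_derivative frechet_derivative f (at u)) (at u)"
  using smooth_on_differentiable[OF assms] by (simp add: frechet_derivative_works)

lemma smooth_on_frechet_derivative:
  assumes "smooth_on S f"
  shows "smooth_on S (\<lambda>u. frechet_derivative f (at u) v)"
  using assms Ck_on.simps(2)[of _ S f] unfolding smooth_on_def by blast

lemma smooth_on_continuous:
  assumes "smooth_on S f"
  shows "continuous_on S f"
  using assms Ck_on.simps(1)[of S f] unfolding smooth_on_def by blast

lemma smooth_on_const: "smooth_on S (\<lambda>_. c)"
proof -
  have "Ck_on k S (\<lambda>_. c)" for k
    by (induction k arbitrary: c) auto
  then show ?thesis
    by (simp add: smooth_on_def)
qed

text \<open>Differentiability is not assumed: two functions that agree near a point have the same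
  candidates for a derivative there, hence the same choice of one.\<close>

lemma frechet_derivative_cong_open:
  assumes "open U" "u \<in> U" "\<And>v. v \<in> U \<Longrightarrow> F v = G v"
  shows "frechet_derivative F (at u) = frechet_derivative G (at u)"
proof -
  have "(F has_derivative D) (at u) \<longleftrightarrow> (G has_derivative D) (at u)" for D
    using has_derivative_transform_within_open[OF _ assms(1,2), of F D UNIV G]
      has_derivative_transform_within_open[OF _ assms(1,2), of G D UNIV F] assms(3) by auto
  then show ?thesis
    by (simp add: frechet_derivative_def)
qed

text \<open>Apply the mean value theorem first to
  \<open>s \<mapsto> F (u + s X + h Y) - F (u + s X)\<close> and then to \<open>t \<mapsto> D (u + s X + t Y) X\<close>. The second
  difference on the left is symmetric in \<open>X\<close> and \<open>Y\<close>, which is what makes mixed derivatives agree.\<close>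

lemma second_difference_mean_value:
  fixes F :: "'v::real_normed_vector \<Rightarrow> real"
  assumes "h > 0"
    and F: "\<And>s t. \<lbrakk>0 \<le> s; s \<le> h; 0 \<le> t; t \<le> h\<rbrakk> \<Longrightarrow>
      (F has_derivative D (u + s *\<^sub>R X + t *\<^sub>R Y)) (at (u + s *\<^sub>R X + t *\<^sub>R Y))"
    and DX: "\<And>s t. \<lbrakk>0 \<le> s; s \<le> h; 0 \<le> t; t \<le> h\<rbrakk> \<Longrightarrow>
      ((\<lambda>q. D q X) has_derivative E (u + s *\<^sub>R X + t *\<^sub>R Y)) (at (u + s *\<^sub>R X + t *\<^sub>R Y))"
  shows "\<exists>s t. 0 < s \<and> s < h \<and> 0 < t \<and> t < h \<and>
    F (u + h *\<^sub>R X + h *\<^sub>R Y) - F (u + h *\<^sub>R X) - F (u + h *\<^sub>R Y) + F u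
      = h\<^sup>2 * E (u + s *\<^sub>R X + t *\<^sub>R Y) Y"
proof -
  define \<phi> where "\<phi> s = F (u + s *\<^sub>R X + h *\<^sub>R Y) - F (u + s *\<^sub>R X)" for s
  have line: "((\<lambda>s. u + s *\<^sub>R X + t *\<^sub>R Y) has_derivative (\<lambda>a. a *\<^sub>R X)) (at s)" for s t
    by (auto intro!: derivative_eq_intros)
  have line': "((\<lambda>t. u + s *\<^sub>R X + t *\<^sub>R Y) has_derivative (\<lambda>a. a *\<^sub>R Y)) (at t)" for s t
    by (auto intro!: derivative_eq_intros)
  have F': "((\<lambda>s. F (u + s *\<^sub>R X + t *\<^sub>R Y)) has_real_derivative D (u + s *\<^sub>R X + t *\<^sub>R Y) X) (at s)"
    if "0 \<le> s" "s \<le> h" "0 \<le> t" "t \<le> h" for s t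
  proof -
    have "((\<lambda>s. F (u + s *\<^sub>R X + t *\<^sub>R Y)) has_derivative (\<lambda>a. D (u + s *\<^sub>R X + t *\<^sub>R Y) (a *\<^sub>R X))) (at s)"
      using diff_chain_at[OF line F[OF that]] by (simp add: o_def)
    then show ?thesis
      using F[OF that, THEN has_derivative_linear]
      by (simp add: has_field_derivative_def linear_cmul mult_commute_abs)
  qed
  have \<phi>': "(\<phi> has_real_derivative D (u + s *\<^sub>R X + h *\<^sub>R Y) X - D (u + s *\<^sub>R X) X) (at s)"
    if "0 \<le> s" "s \<le> h" for s
    unfolding \<phi>_def
    using F'[of s h] F'[of s 0] that \<open>h > 0\<close> by (intro DERIV_diff) auto
  obtain s where s: "0 < s" "s < h"
    "\<phi> h - \<phi> 0 = (h - 0) * (D (u + s *\<^sub>R X + h *\<^sub>R Y) X - D (u + s *\<^sub>R X) X)"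
    using MVT2[OF \<open>h > 0\<close> \<phi>'] by blast
  have E': "((\<lambda>t. D (u + s *\<^sub>R X + t *\<^sub>R Y) X) has_real_derivative E (u + s *\<^sub>R X + t *\<^sub>R Y) Y) (at t)"
    if "0 \<le> t" "t \<le> h" for t
  proof -
    have st: "0 \<le> s" "s \<le> h"
      using s by auto
    have "((\<lambda>t. D (u + s *\<^sub>R X + t *\<^sub>R Y) X) has_derivative (\<lambda>a. E (u + s *\<^sub>R X + t *\<^sub>R Y) (a *\<^sub>R Y))) (at t)"
      using diff_chain_at[OF line' DX[OF st that]] by (simp add: o_def)
    then show ?thesis
      using DX[OF st that, THEN has_derivative_linear]
      by (simp add: has_field_derivative_def linear_cmul mult_commute_abs)
  qed
  obtain t where t: "0 < t" "t < h"
    "D (u + s *\<^sub>R X + h *\<^sub>R Y) X - D (u + s *\<^sub>R X + 0 *\<^sub>R Y) X = (h - 0) * E (u + s *\<^sub>R X + t *\<^sub>R Y) Y"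
    using MVT2[OF \<open>h > 0\<close> E'] by blast
  show ?thesis
    using s t by (intro exI[of _ s] exI[of _ t]) (simp add: \<phi>_def power2_eq_square)
qed

text \<open>Both mixed derivatives, at points of the parallelogram spanned by \<open>h X\<close> and \<open>h Y\<close>, equal the
  same second difference divided by \<open>h\<^sup>2\<close>; let \<open>h\<close> be so small that by continuity each is closer
  to its value at \<open>u\<close> than half the supposed gap.\<close>

lemma symmetric_second_derivative_real:
  fixes F :: "'v::real_normed_vector \<Rightarrow> real"
  assumes "open U" "u \<in> U"
    and F: "\<And>q. q \<in> U \<Longrightarrow> (F has_derivative D q) (at q)"
    and DX: "\<And>q. q \<in> U \<Longrightarrow> ((\<lambda>q. D q X) has_derivative D2X q) (at q)"
    and DY: "\<And>q. q \<in> U \<Longrightarrow> ((\<lambda>q. D q Y) has_derivative D2Y q) (at q)"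
    and cX: "continuous_on U (\<lambda>q. D2X q Y)"
    and cY: "continuous_on U (\<lambda>q. D2Y q X)"
  shows "D2X u Y = D2Y u X"
proof (rule ccontr)
  assume ne: "D2X u Y \<noteq> D2Y u X"
  \<comment> \<open>Half the gap: two values closer than this to the two mixed derivatives cannot coincide.\<close>
  define e where "e = \<bar>D2X u Y - D2Y u X\<bar> / 2"
  have "e > 0"
    using ne by (simp add: e_def)
  obtain r where r: "r > 0" "ball u r \<subseteq> U"
    using \<open>open U\<close> \<open>u \<in> U\<close> open_contains_ball by blast
  obtain d1 where d1: "d1 > 0" "\<And>q. q \<in> U \<Longrightarrow> dist q u < d1 \<Longrightarrow> dist (D2X q Y) (D2X u Y) < e"
    using cX[unfolded continuous_on_iff, rule_format, OF \<open>u \<in> U\<close> \<open>e > 0\<close>] by blast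
  obtain d2 where d2: "d2 > 0" "\<And>q. q \<in> U \<Longrightarrow> dist q u < d2 \<Longrightarrow> dist (D2Y q X) (D2Y u X) < e"
    using cY[unfolded continuous_on_iff, rule_format, OF \<open>u \<in> U\<close> \<open>e > 0\<close>] by blast
  define d where "d = min r (min d1 d2)"
  have "d > 0"
    using r d1 d2 by (simp add: d_def)
  \<comment> \<open>Chosen so that the parallelogram lies within distance \<open>d\<close> of \<open>u\<close>.\<close>
  define h where "h = d / (norm X + norm Y + 1)"
  have n: "norm X + norm Y + 1 > 0"
    using norm_ge_zero[of X] norm_ge_zero[of Y] by linarith
  have "h > 0"
    using \<open>d > 0\<close> n by (simp add: h_def)
  have near: "dist (u + s *\<^sub>R X + t *\<^sub>R Y) u < d" if "0 \<le> s" "s \<le> h" "0 \<le> t" "t \<le> h" for s t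
  proof -
    have "dist (u + s *\<^sub>R X + t *\<^sub>R Y) u \<le> s * norm X + t * norm Y"
      using norm_triangle_ineq[of "s *\<^sub>R X" "t *\<^sub>R Y"] that by (simp add: dist_norm add.assoc)
    also have "\<dots> \<le> h * norm X + h * norm Y"
      using that by (intro add_mono mult_right_mono) auto
    also have "\<dots> < h * (norm X + norm Y + 1)"
      using \<open>h > 0\<close> by (simp add: algebra_simps)
    also have "\<dots> = d"
      using n by (simp add: h_def)
    finally show ?thesis .
  qed
  have inU: "u + s *\<^sub>R X + t *\<^sub>R Y \<in> U" if "0 \<le> s" "s \<le> h" "0 \<le> t" "t \<le> h" for s t
    using near[OF that] r by (auto simp: d_def dist_commute)
  have near': "dist (u + t *\<^sub>R Y + s *\<^sub>R X) u < d" "u + t *\<^sub>R Y + s *\<^sub>R X \<in> U"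
    if "0 \<le> s" "s \<le> h" "0 \<le> t" "t \<le> h" for s t
    using near[OF that] inU[OF that] by (simp_all add: ac_simps)
  obtain s t where st: "0 < s" "s < h" "0 < t" "t < h"
    "F (u + h *\<^sub>R X + h *\<^sub>R Y) - F (u + h *\<^sub>R X) - F (u + h *\<^sub>R Y) + F u
      = h\<^sup>2 * D2X (u + s *\<^sub>R X + t *\<^sub>R Y) Y"
    using second_difference_mean_value[OF \<open>h > 0\<close> F[OF inU] DX[OF inU]] by blast
  obtain s' t' where st': "0 < s'" "s' < h" "0 < t'" "t' < h"
    "F (u + h *\<^sub>R Y + h *\<^sub>R X) - F (u + h *\<^sub>R Y) - F (u + h *\<^sub>R X) + F u
      = h\<^sup>2 * D2Y (u + t' *\<^sub>R Y + s' *\<^sub>R X) X"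
    using second_difference_mean_value[OF \<open>h > 0\<close> F[OF near'(2)] DY[OF near'(2)]] by blast
  have "h\<^sup>2 * D2X (u + s *\<^sub>R X + t *\<^sub>R Y) Y = h\<^sup>2 * D2Y (u + t' *\<^sub>R Y + s' *\<^sub>R X) X"
    using st(5) st'(5) by (simp only: add.commute[of "h *\<^sub>R X"] add.assoc)
  then have "D2X (u + s *\<^sub>R X + t *\<^sub>R Y) Y = D2Y (u + t' *\<^sub>R Y + s' *\<^sub>R X) X"
    using \<open>h > 0\<close> by simp
  moreover have "dist (D2X (u + s *\<^sub>R X + t *\<^sub>R Y) Y) (D2X u Y) < e"
    using near[of s t] inU[of s t] st by (intro d1(2)) (auto simp: d_def)
  moreover have "dist (D2Y (u + t' *\<^sub>R Y + s' *\<^sub>R X) X) (D2Y u X) < e"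
    using near'[of s' t'] st' by (intro d2(2)) (auto simp: d_def)
  ultimately show False
    unfolding e_def dist_real_def by argo
qed

lemma symmetric_second_derivative:
  fixes f :: "'v::real_normed_vector \<Rightarrow> 'e::euclidean_space"
  assumes "open U" "u \<in> U" "smooth_on U f"
  shows "frechet_derivative (\<lambda>q. frechet_derivative f (at q) X) (at u) Y
       = frechet_derivative (\<lambda>q. frechet_derivative f (at q) Y) (at u) X"
proof (rule euclidean_eqI)
  fix b :: 'e
  assume "b \<in> Basis"
  note s = smooth_on_frechet_derivative[OF assms(3)]
  have 1: "((\<lambda>q. f q \<bullet> b) has_derivative (\<lambda>v. frechet_derivative f (at q) v \<bullet> b)) (at q)"
    if "q \<in> U" for q
    by (rule has_derivative_inner_left[OF smooth_on_has_derivative[OF assms(3) that]])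
  have 2: "((\<lambda>q. frechet_derivative f (at q) Z \<bullet> b) has_derivative
      (\<lambda>v. frechet_derivative (\<lambda>q. frechet_derivative f (at q) Z) (at q) v \<bullet> b)) (at q)"
    if "q \<in> U" for q Z
    by (rule has_derivative_inner_left[OF smooth_on_has_derivative[OF s that]])
  have 3: "continuous_on U (\<lambda>q. frechet_derivative (\<lambda>q. frechet_derivative f (at q) Z) (at q) Z' \<bullet> b)"
    for Z Z'
    by (rule continuous_on_inner[OF smooth_on_continuous[OF smooth_on_frechet_derivative[OF s]] continuous_on_const])
  show "frechet_derivative (\<lambda>q. frechet_derivative f (at q) X) (at u) Y \<bullet> b
       = frechet_derivative (\<lambda>q. frechet_derivative f (at q) Y) (at u) X \<bullet> b"
    by (rule symmetric_second_derivative_real[OF assms(1,2) 1 2 2 3 3])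
qed


section \<open>Matrices depending on a parameter and positive definite forms\<close>

lemma linear_axis_expansion:
  fixes L :: "real ^ 'n \<Rightarrow> 'w::real_vector"
  assumes "linear L"
  shows "L V = (\<Sum>i\<in>UNIV. V $ i *\<^sub>R L (axis i 1))"
proof -
  have "V = (\<Sum>i\<in>UNIV. V $ i *\<^sub>R axis i 1)"
    using basis_expansion[of V] by (simp add: scalar_mult_eq_scaleR)
  then have "L V = L (\<Sum>i\<in>UNIV. V $ i *\<^sub>R axis i 1)"
    by simp
  also have "\<dots> = (\<Sum>i\<in>UNIV. V $ i *\<^sub>R L (axis i 1))"
    by (simp add: linear_sum[OF assms] linear_cmul[OF assms])
  finally show ?thesis .
qed

lemma differentiable_det:
  fixes M :: "'v::real_normed_vector \<Rightarrow> real ^ 'n ^ 'n"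
  assumes "\<And>i j. (\<lambda>q. M q $ i $ j) differentiable (at u)"
  shows "(\<lambda>q. det (M q)) differentiable (at u)"
proof -
  obtain D where D: "\<And>i j. ((\<lambda>q. M q $ i $ j) has_derivative D i j) (at u)"
    using assms unfolding differentiable_def by metis
  have "((\<lambda>q. \<Prod>i\<in>UNIV. M q $ i $ p i) has_derivative
      (\<lambda>v. \<Sum>i\<in>UNIV. D i (p i) v * (\<Prod>j\<in>UNIV - {i}. M u $ j $ p j))) (at u)" for p
    by (rule has_derivative_prod) (rule D)
  then have "((\<lambda>q. det (M q)) has_derivative (\<lambda>v. \<Sum>p | p permutes UNIV.
      of_int (sign p) * (\<Sum>i\<in>UNIV. D i (p i) v * (\<Prod>j\<in>UNIV - {i}. M u $ j $ p j)))) (at u)"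
    unfolding det_def by (intro has_derivative_sum has_derivative_mult_right)
  then show ?thesis
    unfolding differentiable_def by blast
qed

lemma differentiable_vec_componentwise:
  fixes V :: "'v::real_normed_vector \<Rightarrow> real ^ 'n"
  assumes "\<And>i. (\<lambda>q. V q $ i) differentiable (at u)"
  shows "V differentiable (at u)"
proof -
  obtain D where D: "\<And>i. ((\<lambda>q. V q $ i) has_derivative D i) (at u)"
    using assms unfolding differentiable_def by metis
  have "((\<lambda>q. \<Sum>i\<in>UNIV. V q $ i *\<^sub>R axis i (1::real)) has_derivative (\<lambda>v. \<Sum>i\<in>UNIV. D i v *\<^sub>R axis i 1)) (at u)"
    by (intro derivative_intros D)
  moreover have "(\<lambda>q. \<Sum>i\<in>UNIV. V q $ i *\<^sub>R axis i (1::real)) = V"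
    by (simp add: basis_expansion flip: scalar_mult_eq_scaleR)
  ultimately show ?thesis
    unfolding differentiable_def by auto
qed

text \<open>By Cramer's rule the solution is a quotient of determinants of differentiable entries.\<close>

lemma differentiable_linear_system_solution:
  fixes M :: "'v::real_normed_vector \<Rightarrow> real ^ 'n ^ 'n"
  assumes "open U" "u \<in> U"
    and M: "\<And>i j. (\<lambda>q. M q $ i $ j) differentiable (at u)"
    and b: "\<And>i. (\<lambda>q. b q $ i) differentiable (at u)"
    and sol: "\<And>q. q \<in> U \<Longrightarrow> M q *v V q = b q"
    and inv: "\<And>q. q \<in> U \<Longrightarrow> invertible (M q)"
  shows "V differentiable (at u)"
proof -
  define C where "C q = (\<chi> k. det (\<chi> i j. if j = k then b q $ i else M q $ i $ j) / det (M q))" for q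
  have C: "C differentiable (at u)"
  proof (rule differentiable_vec_componentwise)
    fix k
    have "(\<lambda>q. det (\<chi> i j. if j = k then b q $ i else M q $ i $ j) / det (M q)) differentiable (at u)"
    proof (rule differentiable_divide)
      show "(\<lambda>q. det (\<chi> i j. if j = k then b q $ i else M q $ i $ j)) differentiable (at u)"
      proof (rule differentiable_det)
        fix i j
        show "(\<lambda>q. (\<chi> i j. if j = k then b q $ i else M q $ i $ j) $ i $ j) differentiable (at u)"
          using M[of i j] b[of i] by (cases "j = k") auto
      qed
      show "(\<lambda>q. det (M q)) differentiable (at u)"
        by (rule differentiable_det) (rule M)
      show "det (M u) \<noteq> 0"
        using inv[OF \<open>u \<in> U\<close>] by (simp add: invertible_det_nz)
    qed
    then show "(\<lambda>q. C q $ k) differentiable (at u)"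
      by (simp add: C_def)
  qed
  have "V q = C q" if "q \<in> U" for q
    using sol[OF that] inv[OF that] cramer[of "M q" "V q" "b q"]
    by (simp add: C_def invertible_det_nz)
  then show ?thesis
    using C assms(1,2) has_derivative_transform_within_open
    unfolding differentiable_def by metis
qed

lemma sum_matrix_eq_inner:
  "(\<Sum>i\<in>UNIV. \<Sum>j\<in>UNIV. (B::real^'n^'n) $ i $ j * (a $ i * c $ j)) = a \<bullet> (B *v c)"
  by (simp add: inner_vec_def matrix_vector_mult_def sum_distrib_left ac_simps)

lemma positive_definite_invertible:
  fixes M :: "real^'n^'n"
  assumes "\<And>y. y \<noteq> 0 \<Longrightarrow> y \<bullet> (M *v y) > 0"
  shows "invertible M"
proof -
  have "\<forall>y. M *v y = 0 \<longrightarrow> y = 0"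
    using assms by (metis inner_zero_right less_irrefl)
  then show ?thesis
    by (simp add: invertible_left_inverse matrix_left_invertible_ker)
qed

text \<open>Put \<open>y = matrix_inv M *v a\<close>; then the quantity is \<open>(M *v y) \<bullet> y\<close>.\<close>

lemma matrix_inv_positive_definite:
  fixes M :: "real^'n^'n"
  assumes "\<And>y. y \<noteq> 0 \<Longrightarrow> y \<bullet> (M *v y) > 0" "a \<noteq> 0"
  shows "a \<bullet> (matrix_inv M *v a) > 0"
proof -
  define y where "y = matrix_inv M *v a"
  have "invertible M"
    using positive_definite_invertible assms(1) .
  then have "M ** matrix_inv M = mat 1"
    unfolding invertible_def matrix_inv_def by (rule someI2_ex) simp
  then have a: "M *v y = a"
    by (simp add: y_def matrix_vector_mul_assoc)
  then have "y \<noteq> 0"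
    using assms(2) by auto
  then show ?thesis
    using assms(1)[of y] a by (simp add: y_def inner_commute)
qed

text \<open>A squared length with respect to a metric vanishes only if the object does: in each coordinate
  of the target space the contraction is the quadratic form of \<open>matrix_inv M\<close>, so the sum over the
  coordinates has nonnegative terms.\<close>

lemma matrix_inv_contraction_eq_0:
  fixes M :: "real^'n^'n" and w :: "'n \<Rightarrow> 'e::euclidean_space"
  assumes pos: "\<And>y. y \<noteq> 0 \<Longrightarrow> y \<bullet> (M *v y) > 0"
    and zero: "(\<Sum>i\<in>UNIV. \<Sum>j\<in>UNIV. matrix_inv M $ i $ j * (w i \<bullet> w j)) = 0"
  shows "w i = 0"
proof -
  define a where "a b = (\<chi> i. w i \<bullet> b)" for b :: 'e
  have nonneg: "a b \<bullet> (matrix_inv M *v a b) \<ge> 0" for b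
    using matrix_inv_positive_definite[OF pos, of "a b"] by (cases "a b = 0") auto
  have "(\<Sum>b\<in>Basis. a b \<bullet> (matrix_inv M *v a b))
      = (\<Sum>b\<in>Basis. \<Sum>i\<in>UNIV. \<Sum>j\<in>UNIV. matrix_inv M $ i $ j * ((w i \<bullet> b) * (w j \<bullet> b)))"
    by (simp add: a_def flip: sum_matrix_eq_inner)
  also have "\<dots> = (\<Sum>i\<in>UNIV. \<Sum>j\<in>UNIV. \<Sum>b\<in>Basis. matrix_inv M $ i $ j * ((w i \<bullet> b) * (w j \<bullet> b)))"
    by (subst sum.swap, intro sum.cong refl, subst sum.swap) simp
  also have "\<dots> = 0"
    using zero by (simp add: euclidean_inner[of "w _" "w _"] sum_distrib_left)
  finally have "\<forall>b\<in>Basis. a b \<bullet> (matrix_inv M *v a b) = 0"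
    using sum_nonneg_eq_0_iff[of Basis "\<lambda>b. a b \<bullet> (matrix_inv M *v a b)"] nonneg by simp
  then have "a b = 0" if "b \<in> Basis" for b
    using matrix_inv_positive_definite[OF pos, of "a b"] that by force
  then show ?thesis
    by (metis (no_types, lifting) a_def euclidean_eqI inner_zero_left vec_lambda_beta zero_index)
qed


section \<open>Hypersurfaces in coordinates\<close>

abbreviation dir_deriv :: "('v::real_normed_vector \<Rightarrow> 'w::real_normed_vector) \<Rightarrow> 'v \<Rightarrow> 'v \<Rightarrow> 'w" (\<open>\<D>\<close>)
  where "\<D> F u \<equiv> frechet_derivative F (at u)"

lemma dir_deriv_eqI: "(F has_derivative F') (at u) \<Longrightarrow> \<D> F u = F'"
  using frechet_derivative_at by metis

lemma dir_deriv_has_derivative: "F differentiable (at u) \<Longrightarrow> (F has_derivative \<D> F u) (at u)"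
  by (simp add: frechet_derivative_works)

text \<open>A piece of a hypersurface with a chosen unit normal, written in coordinates: \<open>f\<close> is the
  parametrization and \<open>\<nu>\<close> the normal along it.\<close>

locale hypersurface_patch =
  fixes U :: "(real ^ 'n::finite) set" and f \<nu> :: "real ^ 'n \<Rightarrow> 'e::euclidean_space"
  assumes codim: "DIM('e) = CARD('n) + 1"
    and open_U: "open U"
    and smooth_f: "smooth_on U f"
    and smooth_\<nu>: "smooth_on U \<nu>"
    and inj_df: "u \<in> U \<Longrightarrow> inj (\<D> f u)"
    and unit: "u \<in> U \<Longrightarrow> norm (\<nu> u) = 1"
    and normal: "u \<in> U \<Longrightarrow> \<nu> u \<bullet> \<D> f u X = 0"
begin

definition shape :: "real ^ 'n \<Rightarrow> real ^ 'n \<Rightarrow> real ^ 'n" where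
  "shape u X = (THE V. \<D> f u V = - \<D> \<nu> u X)"

text \<open>The tangential part of the second derivative of the parametrization. It is the Levi-Civita
  connection of the induced metric, as \<open>levi_civita_unique\<close> shows.\<close>

definition gauss_connection :: "real ^ 'n \<Rightarrow> real ^ 'n \<Rightarrow> real ^ 'n \<Rightarrow> real ^ 'n" where
  "gauss_connection u X Y = (THE V. \<D> f u V =
     \<D> (\<lambda>q. \<D> f q Y) u X - (\<nu> u \<bullet> \<D> (\<lambda>q. \<D> f q Y) u X) *\<^sub>R \<nu> u)"

definition mean_curv :: "real ^ 'n \<Rightarrow> real" where
  "mean_curv u = trace (matrix (shape u)) / real CARD('n)"

definition gram :: "real ^ 'n \<Rightarrow> real ^ 'n ^ 'n" where
  "gram u = (\<chi> i j. \<D> f u (axis i 1) \<bullet> \<D> f u (axis j 1))"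

lemmas smooth_df = smooth_on_frechet_derivative[OF smooth_f]
lemmas smooth_d\<nu> = smooth_on_frechet_derivative[OF smooth_\<nu>]

lemma linear_df: "u \<in> U \<Longrightarrow> linear (\<D> f u)"
  by (rule linear_frechet_derivative[OF smooth_on_differentiable[OF smooth_f]])

lemma linear_d\<nu>: "u \<in> U \<Longrightarrow> linear (\<D> \<nu> u)"
  by (rule linear_frechet_derivative[OF smooth_on_differentiable[OF smooth_\<nu>]])

lemma df_eq_iff: "u \<in> U \<Longrightarrow> \<D> f u V = \<D> f u W \<longleftrightarrow> V = W"
  using inj_df by (auto dest: injD)

lemma df_eqI: "u \<in> U \<Longrightarrow> \<D> f u V = \<D> f u W \<Longrightarrow> V = W"
  by (simp add: df_eq_iff)

lemma unit_inner: "u \<in> U \<Longrightarrow> \<nu> u \<bullet> \<nu> u = 1"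
  using unit by (simp add: norm_eq_1)

lemma d\<nu>_tangential:
  assumes "u \<in> U"
  shows "\<nu> u \<bullet> \<D> \<nu> u X = 0"
proof -
  have "((\<lambda>q. \<nu> q \<bullet> \<nu> q) has_derivative (\<lambda>X. \<nu> u \<bullet> \<D> \<nu> u X + \<D> \<nu> u X \<bullet> \<nu> u)) (at u)"
    by (rule has_derivative_inner) (rule smooth_on_has_derivative[OF smooth_\<nu> assms])+
  moreover have "((\<lambda>q. \<nu> q \<bullet> \<nu> q) has_derivative (\<lambda>X. 0)) (at u)"
    by (rule has_derivative_transform_within_open[OF has_derivative_const open_U assms])
      (simp add: unit_inner)
  ultimately have "(\<lambda>X. \<nu> u \<bullet> \<D> \<nu> u X + \<D> \<nu> u X \<bullet> \<nu> u) = (\<lambda>X. 0)"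
    by (rule has_derivative_unique)
  then have "\<nu> u \<bullet> \<D> \<nu> u X + \<D> \<nu> u X \<bullet> \<nu> u = 0"
    by (rule fun_cong)
  then show ?thesis
    by (simp add: inner_commute)
qed

text \<open>This is where codimension one enters: every vector orthogonal to the normal is tangent.\<close>

lemma range_df:
  assumes "u \<in> U"
  shows "range (\<D> f u) = {w. \<nu> u \<bullet> w = 0}"
proof (rule subspace_dim_equal)
  show "subspace (range (\<D> f u))"
    by (rule linear_subspace_image[OF linear_df[OF assms] subspace_UNIV])
  show "subspace {w. \<nu> u \<bullet> w = 0}"
    by (rule subspace_hyperplane)
  show "range (\<D> f u) \<subseteq> {w. \<nu> u \<bullet> w = 0}"
    using normal[OF assms] by auto
  have "\<nu> u \<noteq> 0"
    using unit[OF assms] by auto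
  then have "dim {w. \<nu> u \<bullet> w = 0} = CARD('n)"
    using dim_hyperplane[of "\<nu> u"] codim by simp
  also have "\<dots> = dim (range (\<D> f u))"
    using dim_image_eq[OF linear_df[OF assms], of UNIV] inj_df[OF assms] by simp
  finally show "dim {w. \<nu> u \<bullet> w = 0} \<le> dim (range (\<D> f u))"
    by simp
qed

lemma df_The:
  assumes "u \<in> U" "\<nu> u \<bullet> w = 0"
  shows "\<D> f u (THE V. \<D> f u V = w) = w"
proof -
  obtain V where V: "\<D> f u V = w"
    using range_df[OF assms(1)] assms(2) by (metis (mono_tags) mem_Collect_eq rangeE)
  then have "\<exists>!V. \<D> f u V = w"
    using df_eq_iff[OF assms(1)] by metis
  then show ?thesis
    by (rule theI')
qed

lemma df_shape: "u \<in> U \<Longrightarrow> \<D> f u (shape u X) = - \<D> \<nu> u X"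
  unfolding shape_def by (rule df_The) (simp_all add: d\<nu>_tangential)

lemma df_gauss_connection:
  "u \<in> U \<Longrightarrow> \<D> f u (gauss_connection u X Y)
    = \<D> (\<lambda>q. \<D> f q Y) u X - (\<nu> u \<bullet> \<D> (\<lambda>q. \<D> f q Y) u X) *\<^sub>R \<nu> u"
  unfolding gauss_connection_def
  by (rule df_The) (simp_all add: inner_diff_right unit_inner)

lemma d2f_eq:
  assumes "u \<in> U"
  shows "\<D> (\<lambda>q. \<D> f q V) u X = (\<Sum>i\<in>UNIV. V $ i *\<^sub>R \<D> (\<lambda>q. \<D> f q (axis i 1)) u X)"
proof -
  have "((\<lambda>q. \<Sum>i\<in>UNIV. V $ i *\<^sub>R \<D> f q (axis i 1)) has_derivative
      (\<lambda>X. \<Sum>i\<in>UNIV. V $ i *\<^sub>R \<D> (\<lambda>q. \<D> f q (axis i 1)) u X)) (at u)"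
    by (intro has_derivative_sum has_derivative_scaleR_right smooth_on_has_derivative[OF smooth_df assms])
  then have "((\<lambda>q. \<D> f q V) has_derivative
      (\<lambda>X. \<Sum>i\<in>UNIV. V $ i *\<^sub>R \<D> (\<lambda>q. \<D> f q (axis i 1)) u X)) (at u)"
    by (rule has_derivative_transform_within_open[OF _ open_U assms])
      (simp add: linear_axis_expansion[OF linear_df, symmetric])
  from dir_deriv_eqI[OF this] show ?thesis
    by simp
qed

lemma linear_d2f:
  assumes "u \<in> U"
  shows "linear (\<lambda>V. \<D> (\<lambda>q. \<D> f q V) u X)"
proof -
  have "linear (\<lambda>V::real ^ 'n. \<Sum>i\<in>UNIV. V $ i *\<^sub>R c i)" for c :: "'n \<Rightarrow> 'e"
    by (rule linearI) (simp_all add: scaleR_left_distrib sum.distrib scaleR_right.sum)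
  then show ?thesis
    by (subst (1) ext[OF d2f_eq[OF assms]])
qed

text \<open>The product rule for a differential applied to a moving vector; it follows from the ordinary
  one after expanding the vector in the coordinate basis.\<close>

lemma df_field_has_derivative:
  assumes "u \<in> U" and V: "(V has_derivative V') (at u)"
  shows "((\<lambda>q. \<D> f q (V q)) has_derivative
    (\<lambda>X. \<D> f u (V' X) + \<D> (\<lambda>q. \<D> f q (V u)) u X)) (at u)"
proof -
  have V_i: "((\<lambda>q. V q $ i) has_derivative (\<lambda>X. V' X $ i)) (at u)" for i
    by (rule bounded_linear.has_derivative[OF bounded_linear_vec_nth V])
  have "((\<lambda>q. \<Sum>i\<in>UNIV. V q $ i *\<^sub>R \<D> f q (axis i 1)) has_derivative
      (\<lambda>X. \<Sum>i\<in>UNIV. V u $ i *\<^sub>R \<D> (\<lambda>q. \<D> f q (axis i 1)) u X + V' X $ i *\<^sub>R \<D> f u (axis i 1))) (at u)"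
    by (intro has_derivative_sum has_derivative_scaleR V_i smooth_on_has_derivative[OF smooth_df assms(1)])
  moreover have "(\<lambda>X. \<Sum>i\<in>UNIV. V u $ i *\<^sub>R \<D> (\<lambda>q. \<D> f q (axis i 1)) u X + V' X $ i *\<^sub>R \<D> f u (axis i 1))
      = (\<lambda>X. \<D> f u (V' X) + \<D> (\<lambda>q. \<D> f q (V u)) u X)"
    by (simp add: sum.distrib linear_axis_expansion[OF linear_df[OF assms(1)], symmetric]
        d2f_eq[OF assms(1), symmetric] add.commute)
  ultimately have "((\<lambda>q. \<Sum>i\<in>UNIV. V q $ i *\<^sub>R \<D> f q (axis i 1)) has_derivative
      (\<lambda>X. \<D> f u (V' X) + \<D> (\<lambda>q. \<D> f q (V u)) u X)) (at u)"
    by simp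
  then show ?thesis
    by (rule has_derivative_transform_within_open[OF _ open_U assms(1)])
      (simp add: linear_axis_expansion[OF linear_df, symmetric])
qed

lemma linear_shape:
  assumes "u \<in> U"
  shows "linear (shape u)"
proof (rule linearI)
  note lin = linear_add[OF linear_df[OF assms]] linear_cmul[OF linear_df[OF assms]]
    linear_add[OF linear_d\<nu>[OF assms]] linear_cmul[OF linear_d\<nu>[OF assms]]
  show "shape u (X + Y) = shape u X + shape u Y" for X Y
    by (rule df_eqI[OF assms]) (simp add: lin df_shape[OF assms])
  show "shape u (c *\<^sub>R X) = c *\<^sub>R shape u X" for c X
    by (rule df_eqI[OF assms]) (simp add: lin df_shape[OF assms])
qed

lemma gauss_connection_sym:
  assumes "u \<in> U"
  shows "gauss_connection u X Y = gauss_connection u Y X"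
proof (rule df_eqI[OF assms])
  show "\<D> f u (gauss_connection u X Y) = \<D> f u (gauss_connection u Y X)"
    unfolding df_gauss_connection[OF assms]
    by (subst (1 2) symmetric_second_derivative[OF open_U assms smooth_f, of Y X]) (rule refl)
qed

lemma linear_gauss_connection:
  assumes "u \<in> U"
  shows "linear (gauss_connection u X)"
proof (rule linearI; rule df_eqI[OF assms])
  note add = linear_add[OF linear_d2f[OF assms, of X]]
  show "\<D> f u (gauss_connection u X (Y + Z)) = \<D> f u (gauss_connection u X Y + gauss_connection u X Z)" for Y Z
    unfolding linear_add[OF linear_df[OF assms]] df_gauss_connection[OF assms] add[of Y Z]
    by (simp add: inner_add_right scaleR_left_distrib)
  note scale = linear_cmul[OF linear_d2f[OF assms, of X]]
  show "\<D> f u (gauss_connection u X (c *\<^sub>R Y)) = \<D> f u (c *\<^sub>R gauss_connection u X Y)" for c Y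
    unfolding linear_cmul[OF linear_df[OF assms]] df_gauss_connection[OF assms] scale[of c Y]
    by (simp add: scaleR_diff_right)
qed

lemma bilinear_gauss_connection:
  assumes "u \<in> U"
  shows "bilinear (gauss_connection u)"
  using linear_gauss_connection[OF assms] gauss_connection_sym[OF assms]
  unfolding bilinear_def by simp

lemma metric_derivative:
  assumes "u \<in> U"
  shows "\<D> (\<lambda>q. \<D> f q Y \<bullet> \<D> f q Z) u X
    = \<D> f u (gauss_connection u X Y) \<bullet> \<D> f u Z + \<D> f u Y \<bullet> \<D> f u (gauss_connection u X Z)"
proof -
  have "((\<lambda>q. \<D> f q Y \<bullet> \<D> f q Z) has_derivative
      (\<lambda>X. \<D> f u Y \<bullet> \<D> (\<lambda>q. \<D> f q Z) u X + \<D> (\<lambda>q. \<D> f q Y) u X \<bullet> \<D> f u Z)) (at u)"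
    by (rule has_derivative_inner) (rule smooth_on_has_derivative[OF smooth_df assms])+
  from dir_deriv_eqI[OF this] show ?thesis
    by (simp add: df_gauss_connection[OF assms] inner_diff_left inner_diff_right normal[OF assms]
        inner_commute[of "\<D> f u Y" "\<nu> u"])
qed

text \<open>Existence is \<open>metric_derivative\<close>. For uniqueness, the difference of two candidates, lowered
  with the metric, is a trilinear form that is symmetric in its first two and skew in its last two
  arguments; such a form vanishes.\<close>

lemma levi_civita_unique:
  assumes "u \<in> U"
  shows "(THE \<Gamma>. bilinear \<Gamma> \<and> (\<forall>X Y. \<Gamma> X Y = \<Gamma> Y X) \<and>
     (\<forall>X Y Z. \<D> (\<lambda>q. \<D> f q Y \<bullet> \<D> f q Z) u X
        = \<D> f u (\<Gamma> X Y) \<bullet> \<D> f u Z + \<D> f u Y \<bullet> \<D> f u (\<Gamma> X Z))) = gauss_connection u"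
proof (rule the_equality)
  show "bilinear (gauss_connection u) \<and> (\<forall>X Y. gauss_connection u X Y = gauss_connection u Y X) \<and>
     (\<forall>X Y Z. \<D> (\<lambda>q. \<D> f q Y \<bullet> \<D> f q Z) u X
        = \<D> f u (gauss_connection u X Y) \<bullet> \<D> f u Z + \<D> f u Y \<bullet> \<D> f u (gauss_connection u X Z))"
    using bilinear_gauss_connection[OF assms] gauss_connection_sym[OF assms] metric_derivative[OF assms]
    by blast
next
  fix \<Gamma>
  assume \<Gamma>: "bilinear \<Gamma> \<and> (\<forall>X Y. \<Gamma> X Y = \<Gamma> Y X) \<and>
     (\<forall>X Y Z. \<D> (\<lambda>q. \<D> f q Y \<bullet> \<D> f q Z) u X
        = \<D> f u (\<Gamma> X Y) \<bullet> \<D> f u Z + \<D> f u Y \<bullet> \<D> f u (\<Gamma> X Z))"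
  define T where "T X Y Z = (\<D> f u (\<Gamma> X Y) - \<D> f u (gauss_connection u X Y)) \<bullet> \<D> f u Z" for X Y Z
  have sym: "T X Y Z = T Y X Z" for X Y Z
    using \<Gamma> gauss_connection_sym[OF assms] by (simp add: T_def)
  have skew: "T X Y Z = - T X Z Y" for X Y Z
  proof -
    have "\<D> f u (\<Gamma> X Y) \<bullet> \<D> f u Z + \<D> f u Y \<bullet> \<D> f u (\<Gamma> X Z)
        = \<D> f u (gauss_connection u X Y) \<bullet> \<D> f u Z + \<D> f u Y \<bullet> \<D> f u (gauss_connection u X Z)"
      using \<Gamma> metric_derivative[OF assms, of Y Z X] by simp
    then show ?thesis
      by (simp add: T_def inner_diff_left inner_commute[of "\<D> f u Y"])
  qed
  have zero: "T X Y Z = 0" for X Y Z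
  proof -
    \<comment> \<open>Alternating the two symmetries three times returns to the start with the sign changed.\<close>
    have "T X Y Z = - T X Z Y" by (rule skew)
    also have "\<dots> = - T Z X Y" by (simp only: sym[of X Z])
    also have "\<dots> = T Z Y X" by (simp only: skew[of Z X Y])
    also have "\<dots> = T Y Z X" by (rule sym)
    also have "\<dots> = - T Y X Z" by (rule skew)
    also have "\<dots> = - T X Y Z" by (simp only: sym[of Y X])
    finally show ?thesis by simp
  qed
  show "\<Gamma> = gauss_connection u"
  proof (intro ext)
    fix X Y
    have "\<D> f u (\<Gamma> X Y - gauss_connection u X Y) \<bullet> \<D> f u (\<Gamma> X Y - gauss_connection u X Y) = 0"
      using zero[of X Y "\<Gamma> X Y - gauss_connection u X Y"]
      by (simp add: T_def linear_diff[OF linear_df[OF assms]])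
    then show "\<Gamma> X Y = gauss_connection u X Y"
      by (simp add: linear_diff[OF linear_df[OF assms]] df_eq_iff[OF assms])
  qed
qed

lemma gram_mult: "u \<in> U \<Longrightarrow> (gram u *v y) $ i = \<D> f u (axis i 1) \<bullet> \<D> f u y"
  by (simp add: gram_def matrix_vector_mult_def linear_axis_expansion[OF linear_df, of u y]
      inner_sum_right mult.commute)

lemma gram_positive_definite:
  assumes "u \<in> U" "y \<noteq> 0"
  shows "y \<bullet> (gram u *v y) > 0"
proof -
  have "y \<bullet> (gram u *v y) = (\<Sum>i\<in>UNIV. y $ i *\<^sub>R \<D> f u (axis i 1)) \<bullet> \<D> f u y"
    by (simp add: inner_vec_def gram_mult[OF assms(1)] inner_sum_left)
  also have "\<dots> = \<D> f u y \<bullet> \<D> f u y"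
    by (simp add: linear_axis_expansion[OF linear_df[OF assms(1)], symmetric])
  finally show ?thesis
    using df_eq_iff[OF assms(1), of y 0] assms(2) linear_0[OF linear_df[OF assms(1)]] by simp
qed

text \<open>Pairing Weingarten's formula with the coordinate tangent vectors gives a linear system for
  \<open>shape q Y\<close> whose matrix is the Gram matrix.\<close>

lemma shape_differentiable:
  assumes "u \<in> U"
  shows "(\<lambda>q. shape q Y) differentiable (at u)"
proof (rule differentiable_linear_system_solution[OF open_U assms])
  show "(\<lambda>q. gram q $ i $ j) differentiable (at u)" for i j
    unfolding gram_def
    by (simp add: smooth_on_differentiable[OF smooth_df assms])
  show "(\<lambda>q. (\<chi> i. \<D> f q (axis i 1) \<bullet> - \<D> \<nu> q Y) $ i) differentiable (at u)" for i
    by (simp add: smooth_on_differentiable[OF smooth_df assms] smooth_on_differentiable[OF smooth_d\<nu> assms])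
  show "gram q *v shape q Y = (\<chi> i. \<D> f q (axis i 1) \<bullet> - \<D> \<nu> q Y)" if "q \<in> U" for q
    by (simp add: vec_eq_iff gram_mult[OF that] df_shape[OF that])
  show "invertible (gram q)" if "q \<in> U" for q
    by (rule positive_definite_invertible) (rule gram_positive_definite[OF that])
qed

lemma d2\<nu>_normal:
  assumes "u \<in> U"
  shows "\<nu> u \<bullet> \<D> (\<lambda>q. \<D> \<nu> q Y) u X = - (\<D> \<nu> u X \<bullet> \<D> \<nu> u Y)"
proof -
  have "((\<lambda>q. \<nu> q \<bullet> \<D> \<nu> q Y) has_derivative
      (\<lambda>X. \<nu> u \<bullet> \<D> (\<lambda>q. \<D> \<nu> q Y) u X + \<D> \<nu> u X \<bullet> \<D> \<nu> u Y)) (at u)"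
    by (intro has_derivative_inner smooth_on_has_derivative[OF smooth_d\<nu> assms]
        smooth_on_has_derivative[OF smooth_\<nu> assms])
  moreover have "((\<lambda>q. \<nu> q \<bullet> \<D> \<nu> q Y) has_derivative (\<lambda>X. 0)) (at u)"
    by (rule has_derivative_transform_within_open[OF has_derivative_const open_U assms])
      (simp add: d\<nu>_tangential)
  ultimately have "(\<lambda>X. \<nu> u \<bullet> \<D> (\<lambda>q. \<D> \<nu> q Y) u X + \<D> \<nu> u X \<bullet> \<D> \<nu> u Y) = (\<lambda>X. 0)"
    by (rule has_derivative_unique)
  then have "\<nu> u \<bullet> \<D> (\<lambda>q. \<D> \<nu> q Y) u X + \<D> \<nu> u X \<bullet> \<D> \<nu> u Y = 0"
    by (rule fun_cong)
  then show ?thesis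
    by simp
qed

text \<open>Differentiate Weingarten's formula. The tangential part is, up to sign, the covariant
  derivative of the field \<open>shape q Y\<close>, and the normal part is given by \<open>d2\<nu>_normal\<close>.\<close>

lemma d2\<nu>_eq:
  assumes "u \<in> U"
  shows "\<D> (\<lambda>q. \<D> \<nu> q Y) u X
    = - \<D> f u (\<D> (\<lambda>q. shape q Y) u X + gauss_connection u X (shape u Y))
      - (\<D> \<nu> u X \<bullet> \<D> \<nu> u Y) *\<^sub>R \<nu> u"
proof -
  let ?S = "\<D> (\<lambda>q. \<D> f q (shape u Y)) u X"
  let ?A' = "\<D> (\<lambda>q. shape q Y) u"
  have "((\<lambda>q. - \<D> f q (shape q Y)) has_derivative
      (\<lambda>X. - (\<D> f u (?A' X) + \<D> (\<lambda>q. \<D> f q (shape u Y)) u X))) (at u)"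
    by (rule has_derivative_minus[OF df_field_has_derivative[OF assms
            dir_deriv_has_derivative[OF shape_differentiable[OF assms]]]])
  then have "((\<lambda>q. \<D> \<nu> q Y) has_derivative
      (\<lambda>X. - (\<D> f u (?A' X) + \<D> (\<lambda>q. \<D> f q (shape u Y)) u X))) (at u)"
    by (rule has_derivative_transform_within_open[OF _ open_U assms]) (simp add: df_shape)
  from dir_deriv_eqI[OF this]
  have eq: "\<D> (\<lambda>q. \<D> \<nu> q Y) u X = - (\<D> f u (?A' X) + ?S)"
    by simp
  then have "\<nu> u \<bullet> ?S = \<D> \<nu> u X \<bullet> \<D> \<nu> u Y"
    using d2\<nu>_normal[OF assms, of Y X] normal[OF assms] by (simp add: inner_diff_right)
  then show ?thesis
    by (simp add: eq linear_add[OF linear_df[OF assms]] df_gauss_connection[OF assms])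
qed

end


section \<open>Recurrent shape operators and the biharmonic equation\<close>

locale recurrent_patch = hypersurface_patch U f \<nu>
  for U :: "(real ^ 'n::finite) set" and f \<nu> :: "real ^ 'n \<Rightarrow> 'e::euclidean_space" +
  fixes \<eta> :: "real ^ 'n \<Rightarrow> real ^ 'n \<Rightarrow> real"
  assumes linear_\<eta>: "u \<in> U \<Longrightarrow> linear (\<eta> u)"
    and \<eta>_differentiable: "u \<in> U \<Longrightarrow> (\<lambda>q. \<eta> q Y) differentiable (at u)"
    and recurrent: "u \<in> U \<Longrightarrow> \<D> (\<lambda>q. shape q Y) u X + gauss_connection u X (shape u Y)
      - shape u (gauss_connection u X Y) = \<eta> u X *\<^sub>R shape u Y"
begin

lemma d2\<nu>_recurrent:
  assumes "u \<in> U"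
  shows "\<D> (\<lambda>q. \<D> \<nu> q Y) u X = \<eta> u X *\<^sub>R \<D> \<nu> u Y + \<D> \<nu> u (gauss_connection u X Y)
    - (\<D> \<nu> u X \<bullet> \<D> \<nu> u Y) *\<^sub>R \<nu> u"
proof -
  have "\<D> (\<lambda>q. shape q Y) u X + gauss_connection u X (shape u Y)
      = \<eta> u X *\<^sub>R shape u Y + shape u (gauss_connection u X Y)"
    using recurrent[OF assms, of Y X] by (simp add: algebra_simps)
  then show ?thesis
    by (simp add: d2\<nu>_eq[OF assms] linear_add[OF linear_df[OF assms]] linear_cmul[OF linear_df[OF assms]]
        df_shape[OF assms])
qed

text \<open>The Codazzi equation. Second derivatives of \<open>\<nu>\<close> are symmetric, and so are the last two terms
  of \<open>d2\<nu>_recurrent\<close>.\<close>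

lemma codazzi_recurrent:
  assumes "u \<in> U"
  shows "\<eta> u X *\<^sub>R \<D> \<nu> u Y = \<eta> u Y *\<^sub>R \<D> \<nu> u X"
  using symmetric_second_derivative[OF open_U assms smooth_\<nu>, of X Y]
    d2\<nu>_recurrent[OF assms, of X Y] d2\<nu>_recurrent[OF assms, of Y X]
    gauss_connection_sym[OF assms, of X Y]
  by (simp add: inner_commute)

lemma trace_shape_gauss_connection:
  assumes "u \<in> U"
  shows "(\<Sum>i\<in>UNIV. shape u (gauss_connection u X (axis i 1)) $ i)
    = (\<Sum>i\<in>UNIV. gauss_connection u X (shape u (axis i 1)) $ i)"
proof -
  have tr: "trace (matrix L) = (\<Sum>i\<in>UNIV. L (axis i 1) $ i)" for L :: "real ^ 'n \<Rightarrow> real ^ 'n"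
    by (simp add: trace_def matrix_def)
  have "trace (matrix (shape u \<circ> gauss_connection u X)) = trace (matrix (gauss_connection u X \<circ> shape u))"
    using trace_mul_sym
    by (simp add: matrix_compose_gen linear_shape[OF assms] linear_gauss_connection[OF assms]
        matrix_compose)
  then show ?thesis
    by (simp add: tr)
qed

text \<open>Trace the recurrence: covariant differentiation commutes with the trace, because the
  commutator of the shape operator with the connection term is traceless.\<close>

lemma mean_curv_has_derivative:
  assumes "u \<in> U"
  shows "(mean_curv has_derivative (\<lambda>X. \<eta> u X * mean_curv u)) (at u)"
proof -
  have mc: "mean_curv = (\<lambda>q. (\<Sum>i\<in>UNIV. shape q (axis i 1) $ i) / real CARD('n))"
    by (simp add: fun_eq_iff mean_curv_def trace_def matrix_def)
  have "(mean_curv has_derivative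
      (\<lambda>X. (\<Sum>i\<in>UNIV. \<D> (\<lambda>q. shape q (axis i 1)) u X $ i) / real CARD('n))) (at u)"
    unfolding mc
    by (intro bounded_linear.has_derivative[OF bounded_linear_divide] has_derivative_sum
        bounded_linear.has_derivative[OF bounded_linear_vec_nth]
        dir_deriv_has_derivative[OF shape_differentiable[OF assms]])
  moreover have "(\<Sum>i\<in>UNIV. \<D> (\<lambda>q. shape q (axis i 1)) u X $ i)
      = \<eta> u X * (\<Sum>i\<in>UNIV. shape u (axis i 1) $ i)" for X
  proof -
    have "\<D> (\<lambda>q. shape q (axis i 1)) u X $ i = \<eta> u X * shape u (axis i 1) $ i
        + (shape u (gauss_connection u X (axis i 1)) $ i - gauss_connection u X (shape u (axis i 1)) $ i)" for i
    proof -
      have "\<D> (\<lambda>q. shape q (axis i 1)) u X = \<eta> u X *\<^sub>R shape u (axis i 1)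
        + (shape u (gauss_connection u X (axis i 1)) - gauss_connection u X (shape u (axis i 1)))"
        using recurrent[OF assms, of "axis i 1" X] by (simp add: algebra_simps)
      then show ?thesis
        by simp
    qed
    then show ?thesis
      using trace_shape_gauss_connection[OF assms, of X]
      by (simp add: sum.distrib sum_subtractf sum_distrib_left)
  qed
  ultimately show ?thesis
    by (simp add: mc)
qed

text \<open>The derivative of the mean curvature is written through \<open>\<eta>\<close>, so that the Hessian brings in the
  derivative of \<open>\<eta>\<close> in place of a second derivative of the mean curvature.\<close>

lemma mean_curv_vector_has_derivative:
  assumes "u \<in> U"
  shows "((\<lambda>q. mean_curv q *\<^sub>R \<nu> q) has_derivative
    (\<lambda>X. mean_curv u *\<^sub>R (\<eta> u X *\<^sub>R \<nu> u + \<D> \<nu> u X))) (at u)"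
proof -
  have "((\<lambda>q. mean_curv q *\<^sub>R \<nu> q) has_derivative
      (\<lambda>X. mean_curv u *\<^sub>R \<D> \<nu> u X + (\<eta> u X * mean_curv u) *\<^sub>R \<nu> u)) (at u)"
    by (intro has_derivative_scaleR mean_curv_has_derivative[OF assms]
        smooth_on_has_derivative[OF smooth_\<nu> assms])
  then show ?thesis
    by (simp add: scaleR_add_right mult.commute add.commute)
qed

text \<open>The three multiples of \<open>\<eta> u X *\<^sub>R \<D> \<nu> u Y\<close> come from the derivative of the mean curvature,
  from the recurrence, and from the derivative of \<open>\<nu>\<close> in the factor \<open>\<eta> q Y *\<^sub>R \<nu> q\<close>; the last has
  \<open>X\<close> and \<open>Y\<close> exchanged, which the Codazzi equation undoes.\<close>

lemma hessian_mean_curv_vector: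
  assumes "u \<in> U"
  shows "\<D> (\<lambda>q. \<D> (\<lambda>q. mean_curv q *\<^sub>R \<nu> q) q Y) u X
      - \<D> (\<lambda>q. mean_curv q *\<^sub>R \<nu> q) u (gauss_connection u X Y)
    = mean_curv u *\<^sub>R ((\<eta> u X * \<eta> u Y + \<D> (\<lambda>q. \<eta> q Y) u X - \<eta> u (gauss_connection u X Y)
          - \<D> \<nu> u X \<bullet> \<D> \<nu> u Y) *\<^sub>R \<nu> u + (3 * \<eta> u X) *\<^sub>R \<D> \<nu> u Y)"
proof -
  let ?G = "\<lambda>q. mean_curv q *\<^sub>R (\<eta> q Y *\<^sub>R \<nu> q + \<D> \<nu> q Y)"
  let ?G' = "\<lambda>X. mean_curv u *\<^sub>R ((\<eta> u Y *\<^sub>R \<D> \<nu> u X + \<D> (\<lambda>q. \<eta> q Y) u X *\<^sub>R \<nu> u) + \<D> (\<lambda>q. \<D> \<nu> q Y) u X)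
      + (\<eta> u X * mean_curv u) *\<^sub>R (\<eta> u Y *\<^sub>R \<nu> u + \<D> \<nu> u Y)"
  have d1: "\<D> (\<lambda>q. mean_curv q *\<^sub>R \<nu> q) q = (\<lambda>X. mean_curv q *\<^sub>R (\<eta> q X *\<^sub>R \<nu> q + \<D> \<nu> q X))"
    if "q \<in> U" for q
    by (rule dir_deriv_eqI[OF mean_curv_vector_has_derivative[OF that]])
  have "(?G has_derivative ?G') (at u)"
    by (intro has_derivative_scaleR has_derivative_add mean_curv_has_derivative[OF assms]
        smooth_on_has_derivative[OF smooth_\<nu> assms] smooth_on_has_derivative[OF smooth_d\<nu> assms]
        dir_deriv_has_derivative[OF \<eta>_differentiable[OF assms]])
  from dir_deriv_eqI[OF this] have "\<D> ?G u X = ?G' X"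
    by simp
  moreover have "\<D> (\<lambda>q. \<D> (\<lambda>q. mean_curv q *\<^sub>R \<nu> q) q Y) u = \<D> ?G u"
    by (rule frechet_derivative_cong_open[OF open_U assms]) (simp add: d1)
  ultimately have "\<D> (\<lambda>q. \<D> (\<lambda>q. mean_curv q *\<^sub>R \<nu> q) q Y) u X = ?G' X"
    by simp
  moreover have "\<eta> u Y *\<^sub>R \<D> \<nu> u X = \<eta> u X *\<^sub>R \<D> \<nu> u Y"
    by (rule codazzi_recurrent[OF assms])
  moreover have "(3 * \<eta> u X) *\<^sub>R \<D> \<nu> u Y
      = \<eta> u X *\<^sub>R \<D> \<nu> u Y + \<eta> u X *\<^sub>R \<D> \<nu> u Y + \<eta> u X *\<^sub>R \<D> \<nu> u Y"
    by (simp flip: scaleR_left_distrib)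
  ultimately show ?thesis
    by (simp add: d1[OF assms] d2\<nu>_recurrent[OF assms] algebra_simps)
qed

lemma mean_curv_eq_0_if_d\<nu>_eq_0:
  assumes "u \<in> U" and "\<And>i. \<D> \<nu> u (axis i 1) = 0"
  shows "mean_curv u = 0"
proof -
  have "\<D> f u (shape u (axis i 1)) = \<D> f u 0" for i
    using df_shape[OF assms(1)] assms(2) linear_0[OF linear_df[OF assms(1)]] by simp
  then have "shape u (axis i 1) = 0" for i
    using df_eq_iff[OF assms(1)] by blast
  then show ?thesis
    by (simp add: mean_curv_def trace_def matrix_def)
qed

text \<open>The Hessian is a multiple of the mean curvature, which can therefore be divided out, and the
  derivative of \<open>\<nu>\<close> is orthogonal to \<open>\<nu>\<close>, so that the normal and the tangential part of the
  biharmonic equation hold separately.\<close>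

lemma biharmonic_components:
  assumes u: "u \<in> U" and H: "mean_curv u \<noteq> 0"
    and biharmonic: "(\<Sum>i\<in>UNIV. \<Sum>j\<in>UNIV. matrix_inv (gram u) $ i $ j *\<^sub>R
      (\<D> (\<lambda>q. \<D> (\<lambda>q. mean_curv q *\<^sub>R \<nu> q) q (axis j 1)) u (axis i 1)
        - \<D> (\<lambda>q. mean_curv q *\<^sub>R \<nu> q) u (gauss_connection u (axis i 1) (axis j 1)))) = 0"
  shows "(\<Sum>i\<in>UNIV. \<Sum>j\<in>UNIV. matrix_inv (gram u) $ i $ j *
      (\<eta> u (axis i 1) * \<eta> u (axis j 1) + \<D> (\<lambda>q. \<eta> q (axis j 1)) u (axis i 1)
        - \<eta> u (gauss_connection u (axis i 1) (axis j 1))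
        - \<D> \<nu> u (axis i 1) \<bullet> \<D> \<nu> u (axis j 1))) = 0" (is "?a = 0")
    and "(\<Sum>i\<in>UNIV. \<Sum>j\<in>UNIV. (matrix_inv (gram u) $ i $ j * \<eta> u (axis i 1)) *\<^sub>R \<D> \<nu> u (axis j 1)) = 0"
      (is "?T = 0")
proof -
  have "mean_curv u *\<^sub>R (?a *\<^sub>R \<nu> u + 3 *\<^sub>R ?T) = 0"
    unfolding biharmonic[symmetric] hessian_mean_curv_vector[OF u]
    by (simp add: scaleR_right.sum scaleR_left.sum scaleR_add_right sum.distrib ac_simps)
  then have eq: "?a *\<^sub>R \<nu> u + 3 *\<^sub>R ?T = 0"
    using H by simp
  \<comment> \<open>Pairing with the normal isolates \<open>?a\<close>, because \<open>?T\<close> is tangential.\<close>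
  have "\<nu> u \<bullet> ?T = 0"
    by (simp add: inner_sum_right d\<nu>_tangential[OF u])
  then have "?a = \<nu> u \<bullet> (?a *\<^sub>R \<nu> u + 3 *\<^sub>R ?T)"
    by (simp only: inner_add_right inner_scaleR_right unit_inner[OF u])
  then show "?a = 0"
    by (simp only: eq inner_zero_right)
  then show "?T = 0"
    using eq by simp
qed

text \<open>Let the mean curvature be nonzero at \<open>q\<close>. The tangential equation multiplied by
  \<open>\<eta> q (axis k 1)\<close> becomes, by Codazzi, the squared length of \<open>\<eta>\<close> times \<open>\<D> \<nu> q (axis k 1)\<close>. So
  either \<open>\<eta>\<close> or the derivative of \<open>\<nu>\<close> vanishes at \<open>q\<close>, and the latter is impossible. Hence \<open>\<eta>\<close>
  vanishes on the open set where the mean curvature is nonzero, together with its derivatives, and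
  the normal equation reduces to the vanishing of the squared length of the derivative of \<open>\<nu>\<close>.\<close>

theorem biharmonic_imp_mean_curv_eq_0:
  assumes biharmonic: "\<And>u. u \<in> U \<Longrightarrow> (\<Sum>i\<in>UNIV. \<Sum>j\<in>UNIV. matrix_inv (gram u) $ i $ j *\<^sub>R
      (\<D> (\<lambda>q. \<D> (\<lambda>q. mean_curv q *\<^sub>R \<nu> q) q (axis j 1)) u (axis i 1)
        - \<D> (\<lambda>q. mean_curv q *\<^sub>R \<nu> q) u (gauss_connection u (axis i 1) (axis j 1)))) = 0"
    and "u \<in> U"
  shows "mean_curv u = 0"
proof (rule ccontr)
  assume H: "mean_curv u \<noteq> 0"
  have \<eta>_zero: "\<eta> q X = 0" if q: "q \<in> U" "mean_curv q \<noteq> 0" for q X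
  proof -
    define a where "a = (\<chi> i. \<eta> q (axis i 1))"
    have "a = 0"
    proof (rule ccontr)
      assume "a \<noteq> 0"
      have "\<D> \<nu> q (axis k 1) = 0" for k
      proof -
        have "(a \<bullet> (matrix_inv (gram q) *v a)) *\<^sub>R \<D> \<nu> q (axis k 1)
            = (\<Sum>i\<in>UNIV. \<Sum>j\<in>UNIV. (matrix_inv (gram q) $ i $ j * \<eta> q (axis i 1)) *\<^sub>R
                \<eta> q (axis j 1) *\<^sub>R \<D> \<nu> q (axis k 1))"
          by (simp add: a_def scaleR_left.sum ac_simps flip: sum_matrix_eq_inner)
        also have "\<dots> = \<eta> q (axis k 1) *\<^sub>R (\<Sum>i\<in>UNIV. \<Sum>j\<in>UNIV.
            (matrix_inv (gram q) $ i $ j * \<eta> q (axis i 1)) *\<^sub>R \<D> \<nu> q (axis j 1))"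
          by (simp only: codazzi_recurrent[OF q(1), of _ "axis k 1"])
            (simp add: scaleR_right.sum ac_simps)
        also have "\<dots> = 0"
          by (simp only: biharmonic_components(2)[OF q biharmonic[OF q(1)]] scaleR_zero_right)
        finally show ?thesis
          using matrix_inv_positive_definite[OF gram_positive_definite[OF q(1)] \<open>a \<noteq> 0\<close>] by simp
      qed
      then show False
        using mean_curv_eq_0_if_d\<nu>_eq_0[OF q(1)] q(2) by blast
    qed
    then show ?thesis
      using linear_axis_expansion[OF linear_\<eta>[OF q(1)], of X] by (simp add: a_def vec_eq_iff)
  qed
  \<comment> \<open>\<open>\<eta>\<close> has to vanish near \<open>u\<close>, not only at \<open>u\<close>, since the normal equation contains its
    derivative.\<close>
  define W where "W = {q \<in> U. mean_curv q \<noteq> 0}"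
  have "continuous_on U mean_curv"
    using mean_curv_has_derivative has_derivative_continuous
    by (intro continuous_at_imp_continuous_on) blast
  then have "open W"
    using continuous_open_preimage[OF _ open_U open_Compl[OF closed_singleton], of mean_curv 0]
    by (simp add: W_def vimage_def Int_def)
  have "u \<in> W"
    using assms(2) H by (simp add: W_def)
  have d\<eta>: "\<D> (\<lambda>q. \<eta> q Y) u = (\<lambda>X. 0)" for Y
  proof -
    have "\<D> (\<lambda>q. \<eta> q Y) u = \<D> (\<lambda>q. 0) u"
      by (rule frechet_derivative_cong_open[OF \<open>open W\<close> \<open>u \<in> W\<close>]) (simp add: W_def \<eta>_zero)
    then show ?thesis
      by simp
  qed
  have "(\<Sum>i\<in>UNIV. \<Sum>j\<in>UNIV. matrix_inv (gram u) $ i $ j *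
      (\<D> \<nu> u (axis i 1) \<bullet> \<D> \<nu> u (axis j 1))) = 0"
    using biharmonic_components(1)[OF assms(2) H biharmonic[OF assms(2)]]
    by (simp add: \<eta>_zero[OF assms(2) H] d\<eta> sum_negf)
  then have "\<D> \<nu> u (axis i 1) = 0" for i
    using matrix_inv_contraction_eq_0[of "gram u" "\<lambda>i. \<D> \<nu> u (axis i 1)"]
      gram_positive_definite[OF assms(2)] by blast
  then show False
    using mean_curv_eq_0_if_d\<nu>_eq_0[OF assms(2)] H by blast
qed

end


section \<open>Charts of an immersed hypersurface\<close>

lemma Ck_on_subset: "Ck_on k S F \<Longrightarrow> T \<subseteq> S \<Longrightarrow> Ck_on k T F"
  by (induction k arbitrary: F) (auto intro: continuous_on_subset)

lemma smooth_on_subset: "smooth_on S F \<Longrightarrow> T \<subseteq> S \<Longrightarrow> smooth_on T F"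
  unfolding smooth_on_def using Ck_on_subset by blast

lemma is_chart_inv:
  assumes "is_chart c" "q \<in> chart_dom c"
  shows "chart_inv c (coord c q) = q"
  using assms by (auto simp: is_chart_def homeomorphism_def)

lemma is_chart_open_image:
  fixes c :: "('a::topological_space, 'n::finite) chart"
  assumes "is_chart c" "open W"
  shows "open (coord c ` (W \<inter> chart_dom c))"
proof -
  have "openin (top_of_set (chart_dom c)) (W \<inter> chart_dom c)"
    using assms(2) by (auto simp: openin_open)
  then have "openin (top_of_set (coord c ` chart_dom c)) (coord c ` (W \<inter> chart_dom c))"
    using assms(1) homeomorphism_imp_open_map by (auto simp: is_chart_def)
  then show ?thesis
    using assms(1) openin_open_trans by (auto simp: is_chart_def)
qed

text \<open>One chart and one local unit normal of an immersed hypersurface. Transporting both to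
  coordinates yields a \<open>hypersurface_patch\<close>, and every invariant of the immersion becomes the one
  defined there.\<close>

locale hypersurface_chart =
  fixes \<A> :: "('a::{t2_space, second_countable_topology}, 'n::finite) chart set"
    and g :: "('a, 'n) metric"
    and x N :: "'a \<Rightarrow> 'e::euclidean_space"
    and W :: "'a set" and c :: "('a, 'n) chart"
  assumes dim: "DIM('e) = CARD('n) + 1"
    and atlas: "smooth_atlas \<A>"
    and immersion: "isometric_immersion \<A> g x"
    and unit_normal: "local_unit_normal \<A> x W N"
    and c: "c \<in> \<A>"
begin

definition patch :: "(real ^ 'n) set" where
  "patch = coord c ` (W \<inter> chart_dom c)"

lemma chart: "is_chart c"
  using atlas c by (simp add: smooth_atlas_def)

lemma inv_patch:
  assumes "u \<in> patch"
  shows "chart_inv c u \<in> W" "chart_inv c u \<in> chart_dom c" "coord c (chart_inv c u) = u"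
  using assms is_chart_inv[OF chart] by (auto simp: patch_def)

lemma coord_patch: "q \<in> W \<inter> chart_dom c \<Longrightarrow> coord c q \<in> patch"
  by (simp add: patch_def)

lemma open_patch: "open patch"
  unfolding patch_def using is_chart_open_image[OF chart] unit_normal by (simp add: local_unit_normal_def)

sublocale hypersurface_patch patch "x \<circ> chart_inv c" "N \<circ> chart_inv c"
proof
  have "smooth_on (coord c ` (manifold \<A> \<inter> chart_dom c)) (x \<circ> chart_inv c)"
    using immersion c by (simp add: isometric_immersion_def smooth_map_on_def)
  moreover have "patch \<subseteq> coord c ` (manifold \<A> \<inter> chart_dom c)"
    using c by (auto simp: patch_def manifold_def)
  ultimately show "smooth_on patch (x \<circ> chart_inv c)"
    by (rule smooth_on_subset)
  show "smooth_on patch (N \<circ> chart_inv c)"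
    using unit_normal c by (simp add: patch_def local_unit_normal_def smooth_map_on_def)
  fix u X
  assume u: "u \<in> patch"
  have "inj (dmap c x (chart_inv c u))"
    using immersion c inv_patch(2)[OF u] by (simp add: isometric_immersion_def)
  then show "inj (\<D> (x \<circ> chart_inv c) u)"
    by (simp add: dmap_def[abs_def] inv_patch(3)[OF u])
  show "norm ((N \<circ> chart_inv c) u) = 1"
    using unit_normal inv_patch(1)[OF u] by (simp add: local_unit_normal_def)
  have "N (chart_inv c u) \<bullet> dmap c x (chart_inv c u) X = 0"
    using unit_normal c inv_patch(1,2)[OF u] by (simp add: local_unit_normal_def)
  then show "(N \<circ> chart_inv c) u \<bullet> \<D> (x \<circ> chart_inv c) u X = 0"
    by (simp add: dmap_def inv_patch(3)[OF u])
qed (use dim open_patch in auto)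

text \<open>The equation between \<open>F\<close> and \<open>G\<close> is needed only on the patch, outside of which \<open>chart_inv c\<close>
  and \<open>N\<close> may be arbitrary.\<close>

lemma dmap_eq_dir_deriv:
  assumes "q \<in> W \<inter> chart_dom c" "\<And>v. v \<in> patch \<Longrightarrow> F (chart_inv c v) = G v"
  shows "dmap c F q = \<D> G (coord c q)"
proof -
  have "\<D> (F \<circ> chart_inv c) (coord c q) = \<D> G (coord c q)"
    by (rule frechet_derivative_cong_open[OF open_patch coord_patch[OF assms(1)]]) (simp add: assms(2))
  then show ?thesis
    by (simp add: dmap_def[abs_def])
qed

lemma metric_eq:
  assumes "q \<in> chart_dom c"
  shows "g c q X Y = \<D> (x \<circ> chart_inv c) (coord c q) X \<bullet> \<D> (x \<circ> chart_inv c) (coord c q) Y"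
  using immersion c assms by (simp add: isometric_immersion_def dmap_def)

lemma metric_matrix_eq: "q \<in> chart_dom c \<Longrightarrow> metric_matrix g c q = gram (coord c q)"
  by (simp add: metric_matrix_def gram_def metric_eq)

lemma shape_operator_eq: "shape_operator x c N q = shape (coord c q)"
  by (simp add: fun_eq_iff shape_operator_def shape_def dmap_def)

lemma mean_curvature_eq: "mean_curvature x c N q = mean_curv (coord c q)"
  by (simp add: mean_curvature_def mean_curv_def shape_operator_eq)

lemma levi_civita_eq:
  assumes q: "q \<in> W \<inter> chart_dom c"
  shows "levi_civita g c q = gauss_connection (coord c q)"
proof -
  have "dmap c (\<lambda>q. g c q Y Z) q
      = \<D> (\<lambda>u. \<D> (x \<circ> chart_inv c) u Y \<bullet> \<D> (x \<circ> chart_inv c) u Z) (coord c q)" for Y Z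
    by (rule dmap_eq_dir_deriv[OF q]) (simp add: metric_eq inv_patch)
  then show ?thesis
    using levi_civita_unique[OF coord_patch[OF q]] q by (simp add: levi_civita_def metric_eq)
qed

lemma laplacian_mean_curvature_vector:
  assumes q: "q \<in> W \<inter> chart_dom c"
  shows "laplacian g c (mean_curvature_vector x c N) q
    = - (\<Sum>i\<in>UNIV. \<Sum>j\<in>UNIV. matrix_inv (gram (coord c q)) $ i $ j *\<^sub>R
      (\<D> (\<lambda>u. \<D> (\<lambda>u. mean_curv u *\<^sub>R (N \<circ> chart_inv c) u) u (axis j 1)) (coord c q) (axis i 1)
        - \<D> (\<lambda>u. mean_curv u *\<^sub>R (N \<circ> chart_inv c) u) (coord c q)
            (gauss_connection (coord c q) (axis i 1) (axis j 1))))"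
proof -
  let ?F = "\<lambda>u. mean_curv u *\<^sub>R (N \<circ> chart_inv c) u"
  have 1: "dmap c (mean_curvature_vector x c N) q = \<D> ?F (coord c q)" if "q \<in> W \<inter> chart_dom c" for q
    by (rule dmap_eq_dir_deriv[OF that])
      (simp add: mean_curvature_vector_def mean_curvature_eq inv_patch)
  have "dmap c (\<lambda>q. dmap c (mean_curvature_vector x c N) q Y) q = \<D> (\<lambda>u. \<D> ?F u Y) (coord c q)" for Y
    by (rule dmap_eq_dir_deriv[OF q]) (subst 1; simp add: inv_patch)
  then show ?thesis
    using q by (simp add: laplacian_def hessian_def 1[OF q] metric_matrix_eq levi_civita_eq)
qed

lemma cov_deriv_endo_shape_operator:
  assumes q: "q \<in> W \<inter> chart_dom c"
  shows "cov_deriv_endo g c X (shape_operator x c N) (\<lambda>_. Y) q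
    = \<D> (\<lambda>u. shape u Y) (coord c q) X + gauss_connection (coord c q) X (shape (coord c q) Y)
      - shape (coord c q) (gauss_connection (coord c q) X Y)"
proof -
  have "dmap c (\<lambda>q. shape_operator x c N q Y) q = \<D> (\<lambda>u. shape u Y) (coord c q)"
    by (rule dmap_eq_dir_deriv[OF q]) (simp add: shape_operator_eq inv_patch)
  moreover have "dmap c (\<lambda>_. Y) q = (\<lambda>_. 0)"
    by (simp add: dmap_eq_dir_deriv[OF q, of _ "\<lambda>_. Y"])
  ultimately show ?thesis
    by (simp add: cov_deriv_endo_def cov_deriv_def levi_civita_eq[OF q] shape_operator_eq)
qed

text \<open>Fields with constant components suffice: for them the derivative term in \<open>cov_deriv\<close> vanishes,
  and the recurrence takes the form used in coordinates.\<close>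

lemma recurrent_imp_recurrent_patch:
  assumes \<eta>: "one_form \<A> \<eta>"
    and recurrent: "\<And>p X Y. p \<in> W \<inter> chart_dom c \<Longrightarrow>
      cov_deriv_endo g c X (shape_operator x c N) (\<lambda>_. Y) p = \<eta> c p X *\<^sub>R shape_operator x c N p Y"
  shows "recurrent_patch patch (x \<circ> chart_inv c) (N \<circ> chart_inv c) (\<lambda>u. \<eta> c (chart_inv c u))"
proof (intro recurrent_patch.intro recurrent_patch_axioms.intro hypersurface_patch_axioms)
  fix u X Y
  assume u: "u \<in> patch"
  note inv = inv_patch[OF u]
  show "linear (\<eta> c (chart_inv c u))"
    using \<eta> c inv(2) by (simp add: one_form_def)
  have "smooth_on (coord c ` chart_dom c) ((\<lambda>p. \<eta> c p Y) \<circ> chart_inv c)"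
    using \<eta> c by (simp add: one_form_def)
  from smooth_on_differentiable[OF this, of u] show "(\<lambda>u. \<eta> c (chart_inv c u) Y) differentiable (at u)"
    using u by (auto simp: patch_def o_def)
  show "\<D> (\<lambda>u. shape u Y) u X + gauss_connection u X (shape u Y) - shape u (gauss_connection u X Y)
      = \<eta> c (chart_inv c u) X *\<^sub>R shape u Y"
    using recurrent[of "chart_inv c u" X Y] cov_deriv_endo_shape_operator[of "chart_inv c u" X Y] inv
    by (simp add: shape_operator_eq)
qed

end

theorem theorem3p6:
  fixes \<A> :: "('a::{t2_space, second_countable_topology}, 'n::finite) chart set"
    and g :: "('a, 'n) metric"
    and x :: "'a \<Rightarrow> 'e::euclidean_space"
  assumes "DIM('e) = CARD('n) + 1"
    and "smooth_atlas \<A>"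
    and "riemannian_metric \<A> g"
    and "isometric_immersion \<A> g x"
    and "biharmonic \<A> g x"
    and "recurrent_shape_operator \<A> g x"
  shows "minimal \<A> x"
  unfolding minimal_def
proof (intro allI impI ballI)
  fix W N c p
  assume N: "local_unit_normal \<A> x W N" and c: "c \<in> \<A>" and p: "p \<in> W \<inter> chart_dom c"
  interpret hypersurface_chart \<A> g x N W c
    using assms N c by unfold_locales
  obtain \<eta> where \<eta>: "one_form \<A> \<eta>"
    and rec: "\<And>W N c p X Y. local_unit_normal \<A> x W N \<Longrightarrow> c \<in> \<A> \<Longrightarrow> p \<in> W \<inter> chart_dom c \<Longrightarrow>
      smooth_on (coord c ` (W \<inter> chart_dom c)) (Y \<circ> chart_inv c) \<Longrightarrow>
      cov_deriv_endo g c X (shape_operator x c N) Y p = \<eta> c p X *\<^sub>R shape_operator x c N p (Y p)"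
    using assms(6) unfolding recurrent_shape_operator_def by blast
  interpret recurrent_patch patch "x \<circ> chart_inv c" "N \<circ> chart_inv c" "\<lambda>u. \<eta> c (chart_inv c u)"
  proof (rule recurrent_imp_recurrent_patch[OF \<eta>])
    fix p X Y
    assume "p \<in> W \<inter> chart_dom c"
    then show "cov_deriv_endo g c X (shape_operator x c N) (\<lambda>_. Y) p = \<eta> c p X *\<^sub>R shape_operator x c N p Y"
      by (rule rec[OF N c]) (simp add: o_def smooth_on_const)
  qed
  have "mean_curv (coord c p) = 0"
  proof (rule biharmonic_imp_mean_curv_eq_0[OF _ coord_patch[OF p]])
    fix u
    assume u: "u \<in> patch"
    have "laplacian g c (mean_curvature_vector x c N) (chart_inv c u) = 0"
      using assms(5) N c inv_patch[OF u] unfolding biharmonic_def by blast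
    then show "(\<Sum>i\<in>UNIV. \<Sum>j\<in>UNIV. matrix_inv (gram u) $ i $ j *\<^sub>R
        (\<D> (\<lambda>u. \<D> (\<lambda>u. mean_curv u *\<^sub>R (N \<circ> chart_inv c) u) u (axis j 1)) u (axis i 1)
          - \<D> (\<lambda>u. mean_curv u *\<^sub>R (N \<circ> chart_inv c) u) u (gauss_connection u (axis i 1) (axis j 1)))) = 0"
      using laplacian_mean_curvature_vector[of "chart_inv c u"] inv_patch[OF u] by simp
  qed
  then show "mean_curvature x c N p = 0"
    by (simp add: mean_curvature_eq)
qed

end
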